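(* Let $n\ge1$, and let $S_n$ act on $\mathbb{R}^{2n}=(\mathbb{R}^2)^n$ by permuting the $n$ pairs. Let $[(x_1,y_1,\ldots,x_n,y_n)]$ and $[(x_1',y_1',\ldots,x_n',y_n')]$ be two orbits of this action. If $$e([(x_1,y_1,\ldots,x_n,y_n)])=e([(x_1',y_1',\ldots,x_n',y_n')])$$ for all elementary 2-symmetric tropical polynomials $e$, then $[(x_1,y_1,\ldots,x_n,y_n)]=[(x_1',y_1',\ldots,x_n',y_n')]$.
   Context: Tropical arithmetic: $a\oplus b=\min(a,b)$, $a\odot b=a+b$. The variables are $x_{1,1},x_{1,2},\ldots,x_{n,1},x_{n,2}$; at a point $(x_1,y_1,\ldots,x_n,y_n)\in\mathbb{R}^{2n}$ one sets $x_{i,1}=x_i$, $x_{i,2}=y_i$. Let $\mathscr{E}_n$ be the set of nonzero $n\times 2$ matrices $E=(e_{i,j})$ with entries in $\{0,1\}$; $S_n$ acts on $\mathscr{E}_n$ by permuting rows. For $E\in\mathscr{E}_n$ let $P(E)$ be the tropical product of the variables $x_{i,j}$ with $e_{i,j}=1$. For each orbit $\{E_1,\ldots,E_m\}\in\mathscr{E}_n/S_n$, the tropical polynomial $P(E_1)\oplus\cdots\oplus P(E_m)$ is called an elementary 2-symmetric tropical polynomial. These functions on $\mathbb{R}^{2n}$ are invariant under the $S_n$-action, so they are well-defined on orbits. *)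

theory Defs
  imports "HOL-Analysis.Analysis"
begin

text \<open>
  The number of pairs is \<open>n = CARD('n)\<close>. Points of \<open>(\<real>\<^sup>2)\<^sup>n\<close> and \<open>n \<times> 2\<close> matrices have types
  \<open>real ^ 2 ^ 'n\<close> and \<open>nat ^ 2 ^ 'n\<close>; the \<open>i\<close>-th pair of \<open>x\<close> is \<open>(x $ i $ 1, x $ i $ 2)\<close>.
\<close>

definition permute_rows :: "('n \<Rightarrow> 'n) \<Rightarrow> 'a ^ 2 ^ 'n \<Rightarrow> 'a ^ 2 ^ ('n::finite)" where
  "permute_rows p x = (\<chi> i. x $ inv p i)"

definition row_orbit :: "'a ^ 2 ^ ('n::finite) \<Rightarrow> ('a ^ 2 ^ 'n) set" where
  "row_orbit x = {permute_rows p x |p. p permutes UNIV}"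

definition zero_one_matrices :: "(nat ^ 2 ^ ('n::finite)) set" where
  "zero_one_matrices = {E. (\<forall>i j. E $ i $ j \<in> {0, 1}) \<and> E \<noteq> 0}"

text \<open>The tropical product of the variables selected by \<open>E\<close> is their ordinary sum.\<close>

definition trop_monomial :: "nat ^ 2 ^ 'n \<Rightarrow> real ^ 2 ^ ('n::finite) \<Rightarrow> real" where
  "trop_monomial E x = (\<Sum>(i, j) \<in> {(i, j). E $ i $ j = 1}. x $ i $ j)"

text \<open>The tropical sum over an orbit is a minimum, taken over a finite nonempty set.\<close>

definition trop_orbit_sum :: "(nat ^ 2 ^ 'n) set \<Rightarrow> real ^ 2 ^ ('n::finite) \<Rightarrow> real" where
  "trop_orbit_sum C x = Min ((\<lambda>E. trop_monomial E x) ` C)"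

definition elementary_2_symmetric :: "(real ^ 2 ^ ('n::finite) \<Rightarrow> real) set" where
  "elementary_2_symmetric = trop_orbit_sum ` (row_orbit ` zero_one_matrices)"

text \<open>
  The function on orbits induced by a function that is constant on orbits;
  see \<open>on_orbit_elementary\<close> for well-definedness in the case of interest.
\<close>

definition on_orbit :: "('a \<Rightarrow> 'b) \<Rightarrow> 'a set \<Rightarrow> 'b" where
  "on_orbit f C = the_elem (f ` C)"

lemma permute_rows_compose:
  assumes "p permutes UNIV" "q permutes UNIV"
  shows "permute_rows p (permute_rows q x) = permute_rows (p \<circ> q) x"
  using assms by (simp add: permute_rows_def vec_eq_iff o_inv_distrib permutes_bij)

lemma self_in_row_orbit: "x \<in> row_orbit x"
proof -
  have "x = permute_rows id x"
    by (simp add: permute_rows_def vec_eq_iff)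
  then show ?thesis
    unfolding row_orbit_def using permutes_id by blast
qed

lemma finite_row_orbit: "finite (row_orbit x)"
proof -
  have "row_orbit x = (\<lambda>p. permute_rows p x) ` {p. p permutes UNIV}"
    by (auto simp: row_orbit_def)
  then show ?thesis
    by (simp add: finite_permutations)
qed

lemma image_permute_rows_row_orbit:
  assumes q: "q permutes UNIV"
  shows "permute_rows q ` row_orbit x = row_orbit x"
proof -
  have sub: "permute_rows r ` row_orbit x \<subseteq> row_orbit x" if r: "r permutes UNIV" for r
  proof
    fix y assume "y \<in> permute_rows r ` row_orbit x"
    then obtain p where p: "p permutes UNIV" and y: "y = permute_rows r (permute_rows p x)"
      unfolding row_orbit_def by blast
    have "y = permute_rows (r \<circ> p) x"
      using y permute_rows_compose[OF r p] by simp
    then show "y \<in> row_orbit x"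
      unfolding row_orbit_def using permutes_compose[OF p r] by blast
  qed
  have "y \<in> permute_rows q ` row_orbit x" if y: "y \<in> row_orbit x" for y
  proof -
    have iq: "inv q permutes UNIV"
      using q by (rule permutes_inv)
    have "permute_rows q (permute_rows (inv q) y) = permute_rows id y"
      by (simp add: permute_rows_compose[OF q iq] permutes_inv_o[OF q])
    also have "\<dots> = y"
      by (simp add: permute_rows_def vec_eq_iff)
    finally have "y = permute_rows q (permute_rows (inv q) y)"
      by simp
    moreover have "permute_rows (inv q) y \<in> row_orbit x"
      using sub[OF iq] y by blast
    ultimately show ?thesis
      by (rule image_eqI)
  qed
  with sub[OF q] show ?thesis
    by blast
qed

lemma trop_monomial_permute_rows:
  assumes p: "p permutes UNIV"
  shows "trop_monomial E (permute_rows p x) = trop_monomial (permute_rows (inv p) E) x"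
proof -
  note [simp] = permutes_inverses[OF p] permutes_inv_inv[OF p]
  show ?thesis
    unfolding trop_monomial_def
    by (rule sum.reindex_bij_witness[where i = "\<lambda>(i, j). (p i, j)" and j = "\<lambda>(i, j). (inv p i, j)"])
      (auto simp: permute_rows_def)
qed

lemma trop_orbit_sum_permute_rows:
  assumes p: "p permutes UNIV"
  shows "trop_orbit_sum (row_orbit E) (permute_rows p x) = trop_orbit_sum (row_orbit E) x"
proof -
  have "(\<lambda>F. trop_monomial F (permute_rows p x)) ` row_orbit E
      = (\<lambda>F. trop_monomial F x) ` (permute_rows (inv p) ` row_orbit E)"
    by (simp add: image_image trop_monomial_permute_rows[OF p])
  then show ?thesis
    by (simp add: trop_orbit_sum_def image_permute_rows_row_orbit[OF permutes_inv[OF p]])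
qed

lemma on_orbit_elementary:
  assumes "e \<in> elementary_2_symmetric"
  shows "on_orbit e (row_orbit x) = e x"
proof -
  from assms obtain E where e: "e = trop_orbit_sum (row_orbit E)"
    unfolding elementary_2_symmetric_def by blast
  have "e y = e x" if y: "y \<in> row_orbit x" for y
  proof -
    from y obtain p where "p permutes UNIV" "y = permute_rows p x"
      unfolding row_orbit_def by blast
    then show ?thesis
      by (simp only: e trop_orbit_sum_permute_rows)
  qed
  then have "e ` row_orbit x = {e x}"
    using self_in_row_orbit[of x] by blast
  then show ?thesis
    by (simp add: on_orbit_def)
qed

end

theory Submission
  imports Defs
begin

text \<open>
  For \<open>p, q, r\<close> real, put \<open>f v = min {0, v\<^sub>1 - p, v\<^sub>2 - q, v\<^sub>1 + v\<^sub>2 - r}\<close>, the tropical affine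
  function whose four terms correspond to the four possible rows of a 0-1 matrix. Distributing the
  minima over the rows, the sum of \<open>f (x\<^sub>i, y\<^sub>i)\<close> over \<open>i\<close> is a minimum over all 0-1 matrices \<open>E\<close> of
  the monomial of \<open>E\<close> minus a price depending only on the orbit of \<open>E\<close>; hence it is determined by
  the elementary polynomials. With \<open>r = s + t - d\<close> versus \<open>r = s + t\<close> at \<open>(p, q) = (s, t)\<close>, the
  difference of two such sums is the sum of \<open>min {(s - x\<^sub>i)\<^sup>+, (t - y\<^sub>i)\<^sup>+, d}\<close>. For small \<open>d\<close>
  this is \<open>d\<close> times the number of points in a quadrant, and inclusion-exclusion over four quadrants
  with corners near \<open>(a, b)\<close> gives the multiplicity of \<open>(a, b)\<close> among the \<open>(x\<^sub>i, y\<^sub>i)\<close>.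
\<close>

definition trop_affine :: "real \<Rightarrow> real \<Rightarrow> real \<Rightarrow> real ^ 2 \<Rightarrow> real" where
  "trop_affine p q r v = min (min 0 (v $ 1 - p)) (min (v $ 2 - q) (v $ 1 + v $ 2 - r))"

definition row_value :: "nat ^ 2 \<Rightarrow> real ^ 2 \<Rightarrow> real" where
  "row_value e v = real (e $ 1) * v $ 1 + real (e $ 2) * v $ 2"

text \<open>The product term corrects the price of the row (1, 1) from \<open>p + q\<close> to
  \<open>r\<close>; the rows (1, 0) and (0, 1) cost \<open>p\<close> and \<open>q\<close>.\<close>

definition row_price :: "real \<Rightarrow> real \<Rightarrow> real \<Rightarrow> nat ^ 2 \<Rightarrow> real" where
  "row_price p q r e =
    real (e $ 1) * p + real (e $ 2) * q + real (e $ 1) * real (e $ 2) * (r - p - q)"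

lemma trop_affine_le_row:
  assumes "\<And>j. e $ j \<in> {0, 1}"
  shows "trop_affine p q r v \<le> row_value e v - row_price p q r e"
  using assms[of 1] assms[of 2] by (auto simp: trop_affine_def row_value_def row_price_def)

lemma trop_affine_eq_row:
  obtains e where "\<And>j. e $ j \<in> {0, 1}"
    and "trop_affine p q r v = row_value e v - row_price p q r e"
proof -
  define row :: "nat \<Rightarrow> nat \<Rightarrow> nat ^ 2" where "row k l = vector [k, l]" for k l
  have row_nth: "row k l $ 1 = k" "row k l $ 2 = l" for k l
    by (simp_all add: row_def)
  have entries: "\<And>j. row k l $ j \<in> {0, 1}" if "k \<in> {0, 1}" "l \<in> {0, 1}" for k l
    using that by (metis exhaust_2 row_nth)
  consider "trop_affine p q r v = 0" | "trop_affine p q r v = v $ 1 - p"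
    | "trop_affine p q r v = v $ 2 - q" | "trop_affine p q r v = v $ 1 + v $ 2 - r"
    unfolding trop_affine_def by linarith
  then show thesis
  proof cases
    case 1
    then show ?thesis
      using that[of "row 0 0"] entries by (simp add: row_value_def row_price_def row_nth)
  next
    case 2
    then show ?thesis
      using that[of "row 1 0"] entries by (simp add: row_value_def row_price_def row_nth)
  next
    case 3
    then show ?thesis
      using that[of "row 0 1"] entries by (simp add: row_value_def row_price_def row_nth)
  next
    case 4
    then show ?thesis
      using that[of "row 1 1"] entries by (simp add: row_value_def row_price_def row_nth)
  qed
qed

lemma trop_monomial_eq_sum_row_value:
  fixes x :: "real ^ 2 ^ ('n::finite)"
  assumes "\<And>i j. E $ i $ j \<in> {0, 1}"
  shows "trop_monomial E x = (\<Sum>i\<in>UNIV. row_value (E $ i) (x $ i))"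
proof -
  have "trop_monomial E x = (\<Sum>(i, j)\<in>UNIV. if E $ i $ j = 1 then x $ i $ j else 0)"
    unfolding trop_monomial_def by (rule sum.mono_neutral_cong_left) (auto split: if_splits)
  also have "\<dots> = (\<Sum>i\<in>UNIV. \<Sum>j\<in>UNIV. if E $ i $ j = 1 then x $ i $ j else 0)"
    by (simp add: sum.cartesian_product)
  also have "\<dots> = (\<Sum>i\<in>UNIV. row_value (E $ i) (x $ i))"
  proof (rule sum.cong[OF refl])
    fix i
    show "(\<Sum>j\<in>UNIV. if E $ i $ j = 1 then x $ i $ j else 0) = row_value (E $ i) (x $ i)"
      using assms[of i 1] assms[of i 2] by (auto simp: sum_2 row_value_def)
  qed
  finally show ?thesis .
qed

text \<open>Applied to \<open>row_price\<close>, this makes the total price of a matrix depend only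
  on its orbit.\<close>

lemma sum_permute_rows:
  fixes E :: "'a ^ 2 ^ ('n::finite)"
  assumes "p permutes UNIV"
  shows "(\<Sum>i\<in>UNIV. g (permute_rows p E $ i)) = (\<Sum>i\<in>UNIV. g (E $ i))"
  using sum.permute[OF permutes_inv[OF assms], of "\<lambda>i. g (E $ i)"]
  by (simp add: permute_rows_def o_def)

lemma trop_orbit_sum_le: "trop_orbit_sum (row_orbit E) x \<le> trop_monomial E x"
  unfolding trop_orbit_sum_def by (intro Min_le) (auto simp: finite_row_orbit self_in_row_orbit)

lemma trop_orbit_sum_attained:
  obtains p where "p permutes UNIV"
    and "trop_orbit_sum (row_orbit E) x = trop_monomial (permute_rows p E) x"
proof -
  have "trop_orbit_sum (row_orbit E) x \<in> (\<lambda>F. trop_monomial F x) ` row_orbit E"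
    unfolding trop_orbit_sum_def
    using self_in_row_orbit[of E] by (intro Min_in) (auto simp: finite_row_orbit)
  then show thesis
    using that unfolding row_orbit_def by blast
qed

text \<open>Rows attaining the minima at \<open>x\<close> form a matrix \<open>E\<close>. The member
  of its orbit that is cheapest at \<open>x'\<close> has the same total price, and its rows bound
  the sum at \<open>x'\<close> from above.\<close>

lemma sum_trop_affine_mono:
  fixes x x' :: "real ^ 2 ^ ('n::finite)"
  assumes "\<And>E. E \<in> zero_one_matrices \<Longrightarrow>
    trop_orbit_sum (row_orbit E) x' \<le> trop_orbit_sum (row_orbit E) x"
  shows "(\<Sum>i\<in>UNIV. trop_affine p q r (x' $ i)) \<le> (\<Sum>i\<in>UNIV. trop_affine p q r (x $ i))"
proof -
  have "\<exists>e. (\<forall>j. e $ j \<in> {0, 1}) \<and>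
      trop_affine p q r (x $ i) = row_value e (x $ i) - row_price p q r e" for i
    using trop_affine_eq_row by metis
  then obtain e where e: "\<And>i j. e i $ j \<in> {0, 1}"
    and eq: "\<And>i. trop_affine p q r (x $ i) = row_value (e i) (x $ i) - row_price p q r (e i)"
    by metis
  define E where "E = (\<chi> i. e i)"
  have E: "\<And>i j. E $ i $ j \<in> {0, 1}"
    using e by (simp add: E_def)
  have x_eq: "(\<Sum>i\<in>UNIV. trop_affine p q r (x $ i)) =
      trop_monomial E x - (\<Sum>i\<in>UNIV. row_price p q r (E $ i))"
    unfolding trop_monomial_eq_sum_row_value[OF E] by (simp add: eq E_def sum_subtractf)
  show ?thesis
  proof (cases "E = 0")
    \<comment> \<open>No elementary polynomial belongs to the zero matrix, but its term 0 occurs in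
      every \<open>trop_affine\<close>.\<close>
    case True
    then have "(\<Sum>i\<in>UNIV. trop_affine p q r (x $ i)) = 0"
      by (simp add: x_eq trop_monomial_def row_price_def)
    moreover have "(\<Sum>i\<in>UNIV. trop_affine p q r (x' $ i)) \<le> 0"
      by (rule sum_nonpos) (simp add: trop_affine_def min_le_iff_disj)
    ultimately show ?thesis
      by simp
  next
    case False
    then have "E \<in> zero_one_matrices"
      using E by (simp add: zero_one_matrices_def)
    then have le: "trop_orbit_sum (row_orbit E) x' \<le> trop_monomial E x"
      using assms trop_orbit_sum_le order_trans by blast
    obtain \<pi> where \<pi>: "\<pi> permutes UNIV"
      and att: "trop_orbit_sum (row_orbit E) x' = trop_monomial (permute_rows \<pi> E) x'"
      by (rule trop_orbit_sum_attained)
    have F: "\<And>i j. permute_rows \<pi> E $ i $ j \<in> {0, 1}"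
      using E by (simp add: permute_rows_def)
    have "(\<Sum>i\<in>UNIV. trop_affine p q r (x' $ i)) \<le>
        (\<Sum>i\<in>UNIV. row_value (permute_rows \<pi> E $ i) (x' $ i)
          - row_price p q r (permute_rows \<pi> E $ i))"
      using F by (intro sum_mono trop_affine_le_row) auto
    also have "\<dots> = trop_monomial (permute_rows \<pi> E) x' - (\<Sum>i\<in>UNIV. row_price p q r (E $ i))"
      by (simp only: sum_subtractf trop_monomial_eq_sum_row_value[OF F] sum_permute_rows[OF \<pi>])
    finally show ?thesis
      using le att x_eq by linarith
  qed
qed

text \<open>At \<open>r = s + t\<close> the function splits as min(0, v1 - s) + min(0, v2 - t).
  Raising its last term by \<open>d > 0\<close> changes the value only where v1 < s and v2 <
  t.\<close>

definition quadrant_bump :: "real \<Rightarrow> real \<Rightarrow> real \<Rightarrow> real ^ 2 \<Rightarrow> real" where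
  "quadrant_bump d s t v = trop_affine s t (s + t - d) v - trop_affine s t (s + t) v"

lemma quadrant_bump_eq:
  assumes "d > 0"
  shows "quadrant_bump d s t v = min (min (max 0 (s - v $ 1)) (max 0 (t - v $ 2))) d"
  using assms unfolding quadrant_bump_def trop_affine_def min_def max_def
  by (auto split: if_splits)

text \<open>The gap hypotheses keep \<open>v\<close> off the ramps, so each bump is \<open>d\<close>
  times the indicator of v1 < s and v2 < t. The alternating sum then factors into a difference in
  \<open>s\<close> times a difference in \<open>t\<close>.\<close>

lemma quadrant_bump_inclusion_exclusion:
  assumes "d > 0"
    and "v $ 1 = a \<or> d \<le> \<bar>v $ 1 - a\<bar>" and "v $ 2 = b \<or> d \<le> \<bar>v $ 2 - b\<bar>"
  shows "quadrant_bump d (a + d) (b + d) v - quadrant_bump d a (b + d) v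
      - quadrant_bump d (a + d) b v + quadrant_bump d a b v
    = (if v $ 1 = a \<and> v $ 2 = b then d else 0)"
proof -
  have "v $ 1 = a \<or> v $ 1 + d \<le> a \<or> a + d \<le> v $ 1"
    and "v $ 2 = b \<or> v $ 2 + d \<le> b \<or> b + d \<le> v $ 2"
    using assms by linarith+
  then show ?thesis
    using \<open>d > 0\<close> unfolding quadrant_bump_eq[OF \<open>d > 0\<close>] by (elim disjE) auto
qed

lemma finite_separation:
  fixes A :: "real set"
  assumes "finite A"
  obtains d where "d > 0" "\<And>u. u \<in> A \<Longrightarrow> u = a \<or> d \<le> \<bar>u - a\<bar>"
proof -
  obtain d where "d > 0" "\<forall>u\<in>A. u \<noteq> a \<longrightarrow> d \<le> dist a u"
    using finite_set_avoid[OF assms] by blast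
  then show thesis
    using that by (metis dist_commute dist_real_def)
qed

lemma card_fiber_eq:
  fixes x x' :: "real ^ 2 ^ ('n::finite)"
  assumes "\<And>p q r. (\<Sum>i\<in>UNIV. trop_affine p q r (x $ i)) = (\<Sum>i\<in>UNIV. trop_affine p q r (x' $ i))"
  shows "card {i. x $ i = w} = card {i. x' $ i = w}"
proof -
  define a b where "a = w $ 1" and "b = w $ 2"
  \<comment> \<open>Pooling all coordinates of both points lets one \<open>d\<close> serve both axes
    and both points.\<close>
  define coords where "coords = range (\<lambda>(i, j). x $ i $ j) \<union> range (\<lambda>(i, j). x' $ i $ j)"
  have "finite coords"
    by (simp add: coords_def)
  then obtain d1 d2 where "d1 > 0" "\<And>u. u \<in> coords \<Longrightarrow> u = a \<or> d1 \<le> \<bar>u - a\<bar>"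
    and "d2 > 0" "\<And>u. u \<in> coords \<Longrightarrow> u = b \<or> d2 \<le> \<bar>u - b\<bar>"
    using finite_separation by metis
  then obtain d where d: "d > 0"
    and sep: "\<And>u. u \<in> coords \<Longrightarrow> u = a \<or> d \<le> \<bar>u - a\<bar>" "\<And>u. u \<in> coords \<Longrightarrow> u = b \<or> d \<le> \<bar>u - b\<bar>"
    by (rule_tac that[of "min d1 d2"]) (fastforce simp: min_le_iff_disj)+
  \<comment> \<open>The right-hand side involves \<open>z\<close> only through sums of bumps, which
    agree for \<open>x\<close> and \<open>x'\<close>.\<close>
  have count: "d * card {i. z $ i = w} =
      (\<Sum>i\<in>UNIV. quadrant_bump d (a + d) (b + d) (z $ i)) - (\<Sum>i\<in>UNIV. quadrant_bump d a (b + d) (z $ i))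
      - (\<Sum>i\<in>UNIV. quadrant_bump d (a + d) b (z $ i)) + (\<Sum>i\<in>UNIV. quadrant_bump d a b (z $ i))"
    if "\<And>i j. z $ i $ j \<in> coords" for z :: "real ^ 2 ^ 'n"
  proof -
    have "d * card {i. z $ i = w} = (\<Sum>i\<in>UNIV. if z $ i = w then d else 0)"
      by (simp add: sum.If_cases)
    also have "\<dots> = (\<Sum>i\<in>UNIV. if z $ i $ 1 = a \<and> z $ i $ 2 = b then d else 0)"
      by (simp add: vec_eq_iff forall_2 a_def b_def)
    also have "\<dots> = (\<Sum>i\<in>UNIV. quadrant_bump d (a + d) (b + d) (z $ i)
        - quadrant_bump d a (b + d) (z $ i)
        - quadrant_bump d (a + d) b (z $ i) + quadrant_bump d a b (z $ i))"
      using d sep that by (intro sum.cong refl quadrant_bump_inclusion_exclusion[symmetric]) auto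
    finally show ?thesis
      by (simp only: sum.distrib sum_subtractf)
  qed
  have "(\<Sum>i\<in>UNIV. quadrant_bump d s t (x $ i)) = (\<Sum>i\<in>UNIV. quadrant_bump d s t (x' $ i))" for s t
    by (simp add: quadrant_bump_def sum_subtractf assms)
  moreover have "x $ i $ j \<in> coords" "x' $ i $ j \<in> coords" for i j
    by (auto simp: coords_def)
  ultimately have "d * card {i. x $ i = w} = d * card {i. x' $ i = w}"
    by (simp only: count)
  then show ?thesis
    using d by simp
qed

lemma row_orbit_permute_rows:
  assumes "p permutes UNIV"
  shows "row_orbit (permute_rows p x) = row_orbit x"
proof -
  have "row_orbit (permute_rows p x) = {permute_rows (q \<circ> p) x |q. q permutes UNIV}"
    unfolding row_orbit_def by (intro Collect_cong) (metis permute_rows_compose assms)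
  also have "\<dots> = row_orbit x"
  proof -
    have "\<exists>q'. q = q' \<circ> p \<and> q' permutes UNIV" if "q permutes UNIV" for q
      using that assms
      by (intro exI[of _ "q \<circ> inv p"]) (simp add: o_assoc[symmetric] permutes_inv_o permutes_compose permutes_inv)
    then show ?thesis
      unfolding row_orbit_def using assms by (blast intro: permutes_compose)
  qed
  finally show ?thesis .
qed

text \<open>Equal multiplicities give equal multisets of rows, and two families on a finite index
  set with the same multiset of values differ by a permutation of the indices.\<close>

lemma row_orbit_eqI:
  fixes x x' :: "'a ^ 2 ^ ('n::finite)"
  assumes "\<And>w. card {i. x $ i = w} = card {i. x' $ i = w}"
  shows "row_orbit x = row_orbit x'"
proof -
  have "image_mset (($) x) (mset_set UNIV) = image_mset (($) x') (mset_set UNIV)"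
    using assms by (simp add: multiset_eq_iff count_image_mset vimage_def)
  then obtain p where p: "p permutes UNIV" "\<forall>i\<in>UNIV. x $ i = x' $ p i"
    using image_mset_eq_implies_permutes[of UNIV "($) x" "($) x'"] by auto
  \<comment> \<open>The inverse appears because \<open>permute_rows\<close> reindexes by the inverse
    of its argument.\<close>
  then have "x = permute_rows (inv p) x'"
    by (simp add: permute_rows_def vec_eq_iff permutes_inv_inv)
  then show ?thesis
    using row_orbit_permute_rows permutes_inv p(1) by blast
qed

theorem proposition5p8:
  fixes x x' :: "real ^ 2 ^ ('n::finite)"
  assumes "\<And>e. e \<in> elementary_2_symmetric \<Longrightarrow>
    on_orbit e (row_orbit x) = on_orbit e (row_orbit x')"
  shows "row_orbit x = row_orbit x'"
proof -
  have "trop_orbit_sum (row_orbit E) x = trop_orbit_sum (row_orbit E) x'"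
    if "E \<in> zero_one_matrices" for E :: "nat ^ 2 ^ 'n"
  proof -
    have "trop_orbit_sum (row_orbit E) \<in> elementary_2_symmetric"
      using that by (simp add: elementary_2_symmetric_def)
    then show ?thesis
      using assms on_orbit_elementary by metis
  qed
  then have "(\<Sum>i\<in>UNIV. trop_affine p q r (x $ i)) = (\<Sum>i\<in>UNIV. trop_affine p q r (x' $ i))" for p q r
    by (intro antisym sum_trop_affine_mono) simp_all
  then show ?thesis
    by (intro row_orbit_eqI card_fiber_eq)
qed

end
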